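(* Let $\sigma=\sigma_1\sigma_2\cdots\sigma_k$ be a permutation of length $k\ge 2$ and let $\hat\sigma=\sigma_2\sigma_1\sigma_3\cdots\sigma_k$. Then $\sigma$ is not effective if and only if $\hat\sigma=1\oplus\alpha$, for some $\alpha\in\mathfrak{S}(231)$.
   Context: A permutation contains a pattern $\tau$ if some subsequence is order isomorphic to $\tau$; otherwise it avoids $\tau$. $\mathfrak{S}(\tau)$ is the set of permutations avoiding $\tau$. The direct sum $1\oplus\alpha$ is the permutation obtained by adding $1$ to every entry of $\alpha$ and prepending the entry $1$. For a permutation $\sigma$ of length at least $2$, the $\sigma$-stack acts on an input permutation $\pi=\pi_1\cdots\pi_n$ as follows (starting with empty stack and output). For $i=1,\dots,n$: as long as pushing $\pi_i$ on top of the stack would make the content of the stack, read from top to bottom, contain an occurrence of $\sigma$, pop the top element and append it to the output; then push $\pi_i$. After all letters have been pushed, pop all remaining elements, from top to bottom, appending them to the output. The resulting output is denoted $\mathcal{S}^{\sigma}(\pi)$. The permutation $\pi$ of length $n$ is $\sigma$-sortable if $\mathcal{S}^{21}(\mathcal{S}^{\sigma}(\pi))=12\cdots n$; $\mathrm{Sort}(\sigma)$ is the set of $\sigma$-sortable permutations. The set of $\sigma$-sorted permutations is $\mathrm{Sorted}(\sigma)=\mathcal{S}^{\sigma}(\mathrm{Sort}(\sigma))$. The pattern $\sigma$ is effective if $\mathrm{Sorted}(\sigma)\subseteq\mathfrak{S}(\sigma)$, i.e. every $\sigma$-sorted permutation avoids $\sigma$. *)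

theory Defs
  imports "HOL-Combinatorics.Multiset_Permutations" "HOL-Library.Sublist"
begin

text \<open>A permutation of length \<open>n\<close> is its one-line notation, a list in
  \<open>permutations_of_set {1..n}\<close>; the empty permutation is allowed.\<close>

definition is_permutation :: "nat list \<Rightarrow> bool" where
  "is_permutation \<pi> \<longleftrightarrow> \<pi> \<in> permutations_of_set {1..length \<pi>}"

definition order_isomorphic :: "nat list \<Rightarrow> nat list \<Rightarrow> bool" where
  "order_isomorphic xs ys \<longleftrightarrow>
     length xs = length ys \<and>
     (\<forall>i < length xs. \<forall>j < length xs. xs ! i < xs ! j \<longleftrightarrow> ys ! i < ys ! j)"

text \<open>Stated for arbitrary lists, since a stack content is a sequence of distinct numbers that
  need not be a permutation of an initial segment.\<close>

definition contains_pattern :: "nat list \<Rightarrow> nat list \<Rightarrow> bool" where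
  "contains_pattern xs \<tau> \<longleftrightarrow> (\<exists>ys. subseq ys xs \<and> order_isomorphic ys \<tau>)"

definition Av :: "nat list \<Rightarrow> nat list set" where
  "Av \<tau> = {\<pi>. is_permutation \<pi> \<and> \<not> contains_pattern \<pi> \<tau>}"

definition one_oplus :: "nat list \<Rightarrow> nat list" where
  "one_oplus \<alpha> = 1 # map Suc \<alpha>"

fun hat :: "nat list \<Rightarrow> nat list" where
  "hat (a # b # xs) = b # a # xs"
| "hat xs = xs"

text \<open>A state is a pair of stack and output. The head of the stack list is its top, so the list is
  the content read from top to bottom. Pushing onto the empty stack needs no test: a single letter
  never contains a pattern of length at least two.\<close>

fun stack_push :: "nat list \<Rightarrow> nat \<Rightarrow> nat list \<times> nat list \<Rightarrow> nat list \<times> nat list" where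
  "stack_push \<sigma> x ([], out) = ([x], out)"
| "stack_push \<sigma> x (y # st, out) =
     (if contains_pattern (x # y # st) \<sigma> then stack_push \<sigma> x (st, out @ [y])
      else (x # y # st, out))"

fun stack_run :: "nat list \<Rightarrow> nat list \<Rightarrow> nat list \<times> nat list \<Rightarrow> nat list" where
  "stack_run \<sigma> [] (st, out) = out @ st"
| "stack_run \<sigma> (x # xs) s = stack_run \<sigma> xs (stack_push \<sigma> x s)"

definition stack_map :: "nat list \<Rightarrow> nat list \<Rightarrow> nat list" where
  "stack_map \<sigma> \<pi> = stack_run \<sigma> \<pi> ([], [])"

definition Sort :: "nat list \<Rightarrow> nat list set" where
  "Sort \<sigma> = {\<pi>. is_permutation \<pi> \<and>
     stack_map [2, 1] (stack_map \<sigma> \<pi>) = [1..<Suc (length \<pi>)]}"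

definition Sorted :: "nat list \<Rightarrow> nat list set" where
  "Sorted \<sigma> = stack_map \<sigma> ` Sort \<sigma>"

definition effective :: "nat list \<Rightarrow> bool" where
  "effective \<sigma> \<longleftrightarrow> Sorted \<sigma> \<subseteq> Av \<sigma>"

end

theory Submission
  imports Defs
begin

text \<open>By Knuth's theorem (\<open>stack_sortable_iff_avoids_231\<close>) the \<open>\<sigma>\<close>-sorted permutations are the
  231-avoiding outputs of the \<open>\<sigma>\<close>-stack, so \<open>\<sigma>\<close> is effective when every output that contains \<open>\<sigma>\<close>
  also contains 231. This is clear if \<open>\<sigma>\<close> itself contains 231. Two more mechanisms produce it.

  First, whenever pushing a letter expels another one, the output acquires an occurrence of
  \<open>hat \<sigma>\<close> (\<open>stack_run_avoiding_hat\<close>). If \<open>hat \<sigma>\<close> contains 231, a 231-avoiding output therefore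
  arises without any early pop: it is the final stack content, which avoids \<open>\<sigma>\<close>.

  Second, suppose that \<open>\<sigma>\<close> starts with its least entry. Then a letter is expelled only by a smaller
  one, so until the final emptying there is a smaller letter in the stack for every letter popped. An
  occurrence of \<open>\<sigma>\<close> in the output cannot have been in the stack as a whole, so its least entry was
  popped before some larger entry was pushed, and these two together with a still smaller letter in
  the stack form 231 (\<open>stack_run_least_first_avoids\<close>).

  If the entry 1 of \<open>\<sigma>\<close> is in third position or later, then the first two entries and 1 form 231
  in \<open>\<sigma>\<close> or in \<open>hat \<sigma>\<close>. So a pattern that is not effective has 1 in second position and avoids 231,
  which is the stated condition.

  Conversely, for such a pattern \<open>s 1 T\<close> the avoidance of 231 makes the entries of \<open>T\<close> below \<open>s\<close>,
  forming a word \<open>L\<close>, precede those above \<open>s\<close>, forming a word \<open>U\<close>. Let primes denote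
  a copy shifted upwards by \<open>s - 1\<close>. The input whose reading from right to left is
  \<open>1 L s' s L' U'\<close> has the output \<open>s 1 L s' L' U'\<close>, because \<open>s'\<close> expels \<open>s\<close> and nothing else is
  expelled. This output contains \<open>s 1 L U'\<close>, a copy of the pattern, and it avoids 231 because all of
  \<open>s 1 L\<close> is smaller than \<open>s' L' U'\<close> and both words are copies of parts of the pattern
  (\<open>least_second_not_effective\<close>).\<close>

section \<open>Order isomorphism and pattern containment\<close>

lemma subseq_set_subset: "subseq xs ys \<Longrightarrow> set xs \<subseteq> set ys"
  by (auto simp: subseq_conv_nths dest: in_set_nthsD)

lemma subseq_distinct: "subseq xs ys \<Longrightarrow> distinct ys \<Longrightarrow> distinct xs"
  by (auto simp: subseq_conv_nths)

text \<open>Pairing up the entries lets one drop, permute or map positions in both lists at once,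
  without index arithmetic.\<close>

lemma order_isomorphic_iff_zip:
  "order_isomorphic xs ys \<longleftrightarrow>
     (\<exists>zs. xs = map fst zs \<and> ys = map snd zs \<and>
       (\<forall>p\<in>set zs. \<forall>q\<in>set zs. fst p < fst q \<longleftrightarrow> snd p < snd q))"
proof
  assume iso: "order_isomorphic xs ys"
  have "\<forall>p\<in>set (zip xs ys). \<forall>q\<in>set (zip xs ys). fst p < fst q \<longleftrightarrow> snd p < snd q"
    using iso by (auto simp: order_isomorphic_def in_set_zip)
  moreover have "xs = map fst (zip xs ys)" "ys = map snd (zip xs ys)"
    using iso by (simp_all add: order_isomorphic_def)
  ultimately show "\<exists>zs. xs = map fst zs \<and> ys = map snd zs \<and>
       (\<forall>p\<in>set zs. \<forall>q\<in>set zs. fst p < fst q \<longleftrightarrow> snd p < snd q)"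
    by blast
next
  assume "\<exists>zs. xs = map fst zs \<and> ys = map snd zs \<and>
       (\<forall>p\<in>set zs. \<forall>q\<in>set zs. fst p < fst q \<longleftrightarrow> snd p < snd q)"
  then show "order_isomorphic xs ys"
    by (auto simp: order_isomorphic_def)
qed

lemma order_isomorphic_length: "order_isomorphic xs ys \<Longrightarrow> length xs = length ys"
  by (simp add: order_isomorphic_def)

lemma order_isomorphic_ConsE:
  assumes "order_isomorphic xs (b # bs)"
  obtains a as where "xs = a # as" "order_isomorphic as bs"
    "list_all2 (\<lambda>u v. (a < u \<longleftrightarrow> b < v) \<and> (u < a \<longleftrightarrow> v < b)) as bs"
proof -
  obtain zs where zs: "xs = map fst zs" "b # bs = map snd zs"
    "\<forall>p\<in>set zs. \<forall>q\<in>set zs. fst p < fst q \<longleftrightarrow> snd p < snd q"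
    using assms unfolding order_isomorphic_iff_zip by iprover
  then obtain z zs' where z: "zs = z # zs'" "b = snd z" "bs = map snd zs'"
    by (cases zs) auto
  have "\<forall>p\<in>set zs'. \<forall>q\<in>set zs'. fst p < fst q \<longleftrightarrow> snd p < snd q"
    using zs(3) z(1) by simp
  then have iso: "order_isomorphic (map fst zs') bs"
    unfolding order_isomorphic_iff_zip using z(3) by iprover
  have "\<forall>q\<in>set zs'. (fst z < fst q \<longleftrightarrow> snd z < snd q) \<and> (fst q < fst z \<longleftrightarrow> snd q < snd z)"
    using zs(3) z(1) by (metis list.set_intros)
  then have "list_all2 (\<lambda>u v. (fst z < u \<longleftrightarrow> b < v) \<and> (u < fst z \<longleftrightarrow> v < b)) (map fst zs') bs"
    unfolding z(2,3) list_all2_map1 list_all2_map2 by (simp add: list.rel_refl_strong)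
  moreover have "xs = fst z # map fst zs'" using zs(1) z(1) by simp
  ultimately show ?thesis using that iso by blast
qed

lemma order_isomorphic_swap:
  assumes "order_isomorphic (a # b # xs) (c # d # ys)"
  shows "order_isomorphic (b # a # xs) (d # c # ys)"
proof -
  obtain zs where zs: "a # b # xs = map fst zs" "c # d # ys = map snd zs"
    "\<forall>p\<in>set zs. \<forall>q\<in>set zs. fst p < fst q \<longleftrightarrow> snd p < snd q"
    using assms unfolding order_isomorphic_iff_zip by iprover
  then obtain p q zs' where "zs = p # q # zs'"
    by (auto simp: Cons_eq_map_conv)
  moreover have "set (q # p # zs') = set (p # q # zs')" by auto
  ultimately have "b # a # xs = map fst (q # p # zs')" "d # c # ys = map snd (q # p # zs')"
    "\<forall>u\<in>set (q # p # zs'). \<forall>v\<in>set (q # p # zs'). fst u < fst v \<longleftrightarrow> snd u < snd v"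
    using zs by (simp, simp, metis)
  then show ?thesis unfolding order_isomorphic_iff_zip by iprover
qed

lemma order_isomorphic_map:
  assumes "strict_mono_on (set xs) f"
  shows "order_isomorphic (map f xs) xs"
  unfolding order_isomorphic_iff_zip
  using assms strict_mono_on_less[OF assms]
  by (intro exI[of _ "map (\<lambda>x. (f x, x)) xs"]) (auto simp: comp_def)

lemma order_isomorphic_subseq:
  assumes "order_isomorphic ys \<tau>" "subseq \<rho> \<tau>"
  obtains ys' where "subseq ys' ys" "order_isomorphic ys' \<rho>"
proof -
  obtain zs where zs: "ys = map fst zs" "\<tau> = map snd zs"
    "\<forall>p\<in>set zs. \<forall>q\<in>set zs. fst p < fst q \<longleftrightarrow> snd p < snd q"
    using assms(1) unfolding order_isomorphic_iff_zip by iprover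
  obtain N where "\<rho> = nths \<tau> N" using assms(2) by (auto simp: subseq_conv_nths)
  then have "order_isomorphic (map fst (nths zs N)) \<rho>"
    unfolding order_isomorphic_iff_zip using zs(2,3)
    by (intro exI[of _ "nths zs N"]) (simp add: nths_map, metis notin_set_nthsI)
  moreover have "subseq (map fst (nths zs N)) ys"
    using subseq_map[of "nths zs N" zs fst] zs(1) by (auto simp: subseq_conv_nths)
  ultimately show ?thesis using that by blast
qed

lemma order_isomorphic_trans:
  "order_isomorphic xs ys \<Longrightarrow> order_isomorphic ys zs \<Longrightarrow> order_isomorphic xs zs"
  by (simp add: order_isomorphic_def)

lemma contains_pattern_trans:
  assumes "contains_pattern xs \<tau>" "contains_pattern \<tau> \<rho>"
  shows "contains_pattern xs \<rho>"
proof -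
  obtain ys where ys: "subseq ys xs" "order_isomorphic ys \<tau>"
    using assms(1) by (auto simp: contains_pattern_def)
  obtain \<rho>' where \<rho>': "subseq \<rho>' \<tau>" "order_isomorphic \<rho>' \<rho>"
    using assms(2) by (auto simp: contains_pattern_def)
  obtain ys' where "subseq ys' ys" "order_isomorphic ys' \<rho>'"
    using order_isomorphic_subseq ys(2) \<rho>'(1) by blast
  then show ?thesis
    using ys(1) \<rho>'(2) order_isomorphic_trans subseq_order.trans
    unfolding contains_pattern_def by blast
qed

lemma contains_pattern_mono:
  "contains_pattern xs \<tau> \<Longrightarrow> subseq xs ys \<Longrightarrow> contains_pattern ys \<tau>"
  unfolding contains_pattern_def using subseq_order.trans by blast

lemma contains_pattern_length: "contains_pattern xs \<tau> \<Longrightarrow> length \<tau> \<le> length xs"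
  by (metis contains_pattern_def list_emb_length order_isomorphic_length)

lemma contains_21_iff:
  "contains_pattern xs [2, 1] \<longleftrightarrow> (\<exists>a b. subseq [a, b] xs \<and> b < a)"
proof
  assume "contains_pattern xs [2, 1]"
  then obtain ys where ys: "subseq ys xs" "order_isomorphic ys [2, 1]"
    by (auto simp: contains_pattern_def)
  then obtain a b where ab: "ys = [a, b]"
    by (auto dest!: order_isomorphic_length simp: length_Suc_conv)
  with ys(2) have "b < a" by (auto elim!: order_isomorphic_ConsE)
  with ys(1) ab show "\<exists>a b. subseq [a, b] xs \<and> b < a" by blast
next
  assume "\<exists>a b. subseq [a, b] xs \<and> b < a"
  then obtain a b where ab: "subseq [a, b] xs" "b < a" by blast
  then have "order_isomorphic [a, b] [2, 1]"
    by (auto simp: order_isomorphic_def less_Suc_eq)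
  with ab show "contains_pattern xs [2, 1]" by (auto simp: contains_pattern_def)
qed

lemma contains_231_iff:
  "contains_pattern xs [2, 3, 1] \<longleftrightarrow> (\<exists>a b c. subseq [a, b, c] xs \<and> c < a \<and> a < b)"
proof
  assume "contains_pattern xs [2, 3, 1]"
  then obtain ys where ys: "subseq ys xs" "order_isomorphic ys [2, 3, 1]"
    by (auto simp: contains_pattern_def)
  then obtain a b c where abc: "ys = [a, b, c]"
    by (auto dest!: order_isomorphic_length simp: length_Suc_conv)
  with ys(2) have "c < a" "a < b" by (auto elim!: order_isomorphic_ConsE)
  with ys(1) abc show "\<exists>a b c. subseq [a, b, c] xs \<and> c < a \<and> a < b" by blast
next
  assume "\<exists>a b c. subseq [a, b, c] xs \<and> c < a \<and> a < b"
  then obtain a b c where abc: "subseq [a, b, c] xs" "c < a" "a < b" by blast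
  then have "order_isomorphic [a, b, c] [2, 3, 1]"
    by (auto simp: order_isomorphic_def less_Suc_eq)
  with abc show "contains_pattern xs [2, 3, 1]" by (auto simp: contains_pattern_def)
qed

lemma is_permutation_iff: "is_permutation xs \<longleftrightarrow> set xs = {1..length xs} \<and> distinct xs"
  by (simp add: is_permutation_def permutations_of_set_def)

section \<open>The pattern-avoiding stack\<close>

text \<open>Here \<open>p\<close> consists of the letters that \<open>x\<close> expels. Removing the last of them makes the push
  legal, so that letter belongs to every occurrence of \<open>\<sigma>\<close> present just before its removal.\<close>

lemma stack_push_cases:
  assumes "length \<sigma> \<ge> 2"
  obtains p r where "st = p @ r" "stack_push \<sigma> x (st, out) = (x # r, out @ p)"
    "\<not> contains_pattern (x # r) \<sigma>"
    "p \<noteq> [] \<Longrightarrow> contains_pattern (x # last p # r) \<sigma>"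
proof -
  have "\<exists>p r. st = p @ r \<and> stack_push \<sigma> x (st, out) = (x # r, out @ p) \<and>
    \<not> contains_pattern (x # r) \<sigma> \<and> (p \<noteq> [] \<longrightarrow> contains_pattern (x # last p # r) \<sigma>)"
  proof (induction st arbitrary: out)
    case Nil
    have "\<not> contains_pattern [x] \<sigma>" using assms contains_pattern_length by fastforce
    then show ?case by simp
  next
    case (Cons y st)
    show ?case
    proof (cases "contains_pattern (x # y # st) \<sigma>")
      case True
      obtain p r where "st = p @ r" "stack_push \<sigma> x (st, out @ [y]) = (x # r, (out @ [y]) @ p)"
        "\<not> contains_pattern (x # r) \<sigma>" "p \<noteq> [] \<longrightarrow> contains_pattern (x # last p # r) \<sigma>"
        using Cons.IH by blast
      with True show ?thesis by (intro exI[of _ "y # p"] exI[of _ r]) auto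
    next
      case False
      then show ?thesis by (intro exI[of _ "[]"] exI[of _ "y # st"]) auto
    qed
  qed
  then show ?thesis using that by blast
qed

text \<open>The stack empties from top to bottom, so its present content is a subsequence of the part of
  the output that is still to be written.\<close>

lemma stack_run_extends:
  assumes "length \<sigma> \<ge> 2"
  obtains w where "stack_run \<sigma> xs (st, out) = out @ w" "subseq st w" "mset w = mset st + mset xs"
proof -
  have "\<exists>w. stack_run \<sigma> xs (st, out) = out @ w \<and> subseq st w \<and> mset w = mset st + mset xs"
  proof (induction xs arbitrary: st out)
    case (Cons x xs)
    obtain p r where pr: "st = p @ r" "stack_push \<sigma> x (st, out) = (x # r, out @ p)"
      using stack_push_cases[OF assms] by metis
    obtain w where w: "stack_run \<sigma> xs (x # r, out @ p) = (out @ p) @ w" "subseq (x # r) w"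
      "mset w = mset (x # r) + mset xs"
      using Cons.IH by blast
    have "subseq r w" using w(2) by (rule subseq_Cons')
    then have "subseq st (p @ w)" unfolding pr(1) subseq_append' .
    then show ?case using pr w by (intro exI[of _ "p @ w"]) simp
  qed simp
  then show ?thesis using that by blast
qed

lemma mset_stack_map: "length \<sigma> \<ge> 2 \<Longrightarrow> mset (stack_map \<sigma> \<pi>) = mset \<pi>"
  unfolding stack_map_def using stack_run_extends[of \<sigma> \<pi> "[]" "[]"]
  by (metis append_Nil mset.simps(1) add_0)

lemma is_permutation_stack_map:
  assumes "length \<sigma> \<ge> 2" "is_permutation \<pi>"
  shows "is_permutation (stack_map \<sigma> \<pi>)"
  using mset_stack_map[OF assms(1), of \<pi>] assms(2)
  by (metis is_permutation_iff mset_eq_imp_distinct_iff mset_eq_setD mset_eq_length)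

lemma stack_run_no_pop:
  assumes "\<not> contains_pattern (rev xs @ st) \<sigma>"
  shows "stack_run \<sigma> (xs @ ys) (st, out) = stack_run \<sigma> ys (rev xs @ st, out)"
  using assms
proof (induction xs arbitrary: st)
  case (Cons x xs)
  have "\<not> contains_pattern (x # st) \<sigma>"
    using Cons.prems contains_pattern_mono[of "x # st" \<sigma> "rev (x # xs) @ st"]
    by (auto simp: subseq_drop_many)
  then have "stack_push \<sigma> x (st, out) = (x # st, out)" by (cases st) auto
  with Cons show ?case by simp
qed simp

section \<open>Sorting with a classical stack\<close>

lemma length_21: "length [2 :: nat, 1] \<ge> 2"
  by simp

lemma avoids_21_first_least:
  assumes "\<not> contains_pattern (x # r) [2, 1]" "z \<in> set r"
  shows "x \<le> z"
  using assms unfolding contains_21_iff by (metis leI subseq_Cons2 subseq_singleton_left)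

lemma stack_run_21_popped_greater_not_sorted:
  assumes "b \<in> set out" "a \<in> set st \<union> set xs" "a < b"
  shows "\<not> sorted (stack_run [2, 1] xs (st, out))"
proof -
  obtain w where w: "stack_run [2, 1] xs (st, out) = out @ w" "mset w = mset st + mset xs"
    using stack_run_extends[OF length_21] by metis
  have "a \<in> set w" using assms(2) w(2) by (metis Un_iff set_mset_mset set_mset_union)
  with assms w show ?thesis by (force simp: sorted_append)
qed

lemma stack_run_21_not_sorted_aux:
  assumes "b \<in> set st \<union> set out" "subseq [c, a] xs" "a < b" "b < c"
  shows "\<not> sorted (stack_run [2, 1] xs (st, out))"
  using assms(1,2)
proof (induction xs arbitrary: st out)
  case (Cons x xs)
  obtain p r where pr: "st = p @ r" "stack_push [2, 1] x (st, out) = (x # r, out @ p)"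
    "\<not> contains_pattern (x # r) [2, 1]"
    using stack_push_cases[OF length_21] by metis
  show ?case
  proof (cases "x = c")
    case True
    have "b \<notin> set r"
      using avoids_21_first_least[OF pr(3)] assms(4) True by force
    then have "b \<in> set (out @ p)" using Cons.prems(1) pr(1) by auto
    moreover have "a \<in> set xs" using Cons.prems(2) True by (auto simp: subseq_singleton_left)
    ultimately show ?thesis
      using stack_run_21_popped_greater_not_sorted[of b "out @ p" a "x # r" xs] assms(3) pr(2)
      by simp
  next
    case False
    then show ?thesis using Cons.IH[of "x # r" "out @ p"] Cons.prems pr(1,2) by auto
  qed
qed simp

lemma stack_run_21_not_sorted:
  assumes "subseq [b, c, a] xs" "a < b" "b < c"
  shows "\<not> sorted (stack_run [2, 1] xs (st, out))"
  using assms(1)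
proof (induction xs arbitrary: st out rule: list.induct)
  case (Cons x xs)
  obtain p r where pr: "st = p @ r" "stack_push [2, 1] x (st, out) = (x # r, out @ p)"
    using stack_push_cases[OF length_21] by metis
  show ?case
  proof (cases "x = b")
    case True
    then show ?thesis
      using stack_run_21_not_sorted_aux[of b "x # r" "out @ p" c a xs] assms Cons.prems pr(2) by simp
  next
    case False
    then show ?thesis using Cons pr(2) by simp
  qed
qed simp

text \<open>The third hypothesis says that no letter \<open>b\<close> of the stack will be expelled by a letter \<open>c\<close>
  while a letter \<open>a < b\<close> is still to come; the fourth hands this property on to each letter pushed.\<close>

lemma stack_run_21_sorted:
  assumes "sorted (out @ st)" "\<forall>b\<in>set out. \<forall>x\<in>set xs. b \<le> x"
    "\<forall>b\<in>set st. \<forall>c a. subseq [c, a] xs \<longrightarrow> a < b \<longrightarrow> \<not> b < c"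
    "\<not> contains_pattern xs [2, 3, 1]"
  shows "sorted (stack_run [2, 1] xs (st, out))"
  using assms
proof (induction xs arbitrary: st out)
  case (Cons x xs)
  obtain p r where pr: "st = p @ r" "stack_push [2, 1] x (st, out) = (x # r, out @ p)"
    "\<not> contains_pattern (x # r) [2, 1]" "p \<noteq> [] \<longrightarrow> contains_pattern (x # last p # r) [2, 1]"
    using stack_push_cases[OF length_21] by metis
  have xr: "\<forall>z\<in>set r. x \<le> z"
    using avoids_21_first_least pr(3) by blast
  have px: "\<forall>b\<in>set p. b < x"
  proof
    fix b assume b: "b \<in> set p"
    then obtain q where q: "p = q @ [last p]" by (metis append_butlast_last_id empty_iff list.set(1))
    have "sorted (q @ last p # r)" using Cons.prems(1) pr(1) q
      by (metis append.assoc append_Cons append_Nil sorted_append)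
    then have srt: "\<forall>u\<in>set q. u \<le> last p" "\<forall>v\<in>set r. last p \<le> v" "sorted r"
      by (auto simp: sorted_append)
    obtain u v where uv: "subseq [u, v] (x # last p # r)" "v < u"
      using b pr(4) unfolding contains_21_iff by (metis empty_iff list.set(1))
    have "last p < x"
    proof (rule ccontr)
      assume "\<not> last p < x"
      with srt xr have "sorted (x # last p # r)" by auto
      then have "sorted [u, v]" using uv(1) unfolding subseq_conv_nths by (metis sorted_nths)
      with uv(2) show False by simp
    qed
    moreover have "b \<in> set q \<union> {last p}"
      using b q by (metis Un_iff list.set(1) list.simps(15) set_append)
    ultimately show "b < x" using srt(1) by auto
  qed
  have "sorted (stack_run [2, 1] xs (x # r, out @ p))"
  proof (rule Cons.IH)
    show "sorted ((out @ p) @ x # r)"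
      using Cons.prems(1,2) pr(1) xr px by (auto simp: sorted_append less_imp_le)
    show "\<forall>b\<in>set (out @ p). \<forall>y\<in>set xs. b \<le> y"
    proof (intro ballI)
      fix b y assume b: "b \<in> set (out @ p)" and y: "y \<in> set xs"
      have "subseq [x, y] (x # xs)" using y by (simp add: subseq_singleton_left)
      then show "b \<le> y" using b y Cons.prems(2,3) pr(1) px
        by (metis Un_iff list.set_intros(2) linorder_not_less set_append)
    qed
    show "\<forall>b\<in>set (x # r). \<forall>c a. subseq [c, a] xs \<longrightarrow> a < b \<longrightarrow> \<not> b < c"
    proof (intro ballI allI impI notI)
      fix b c a assume b: "b \<in> set (x # r)" and ca: "subseq [c, a] xs" "a < b" "b < c"
      show False
      proof (cases "b = x")
        case True
        then have "subseq [b, c, a] (x # xs)" using ca(1) by simp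
        then show False using Cons.prems(4) ca unfolding contains_231_iff by blast
      next
        case False
        then have "b \<in> set st" using b pr(1) by simp
        moreover have "subseq [c, a] (x # xs)" using ca(1) by (rule list_emb_Cons)
        ultimately show False using Cons.prems(3) ca by blast
      qed
    qed
    show "\<not> contains_pattern xs [2, 3, 1]"
      using Cons.prems(4) contains_pattern_mono[of xs _ "x # xs"] by auto
  qed
  then show ?case using pr(2) by simp
qed simp

text \<open>Knuth's theorem. If \<open>b c a\<close> is an occurrence of 231, then pushing \<open>c\<close> expels \<open>b\<close> before the
  smaller \<open>a\<close> is read. Otherwise a letter is expelled only when no smaller one is still to come.\<close>

lemma stack_sortable_iff_avoids_231:
  "sorted (stack_map [2, 1] xs) \<longleftrightarrow> \<not> contains_pattern xs [2, 3, 1]"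
proof
  assume "sorted (stack_map [2, 1] xs)"
  then show "\<not> contains_pattern xs [2, 3, 1]"
    unfolding stack_map_def contains_231_iff using stack_run_21_not_sorted by blast
next
  assume "\<not> contains_pattern xs [2, 3, 1]"
  then show "sorted (stack_map [2, 1] xs)"
    unfolding stack_map_def using stack_run_21_sorted[of "[]" "[]"] by simp
qed

lemma Sort_iff:
  assumes "length \<sigma> \<ge> 2"
  shows "\<pi> \<in> Sort \<sigma> \<longleftrightarrow>
    is_permutation \<pi> \<and> \<not> contains_pattern (stack_map \<sigma> \<pi>) [2, 3, 1]"
proof (cases "is_permutation \<pi>")
  case True
  let ?\<omega> = "stack_map [2, 1] (stack_map \<sigma> \<pi>)"
  have "mset ?\<omega> = mset \<pi>" using mset_stack_map assms by simp
  then have "distinct ?\<omega>" "set ?\<omega> = {1..length \<pi>}"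
    using True
    by (metis is_permutation_iff mset_eq_imp_distinct_iff,
        metis True is_permutation_iff mset_eq_setD)
  moreover have "set [1..<Suc (length \<pi>)] = {1..length \<pi>}" by auto
  ultimately have "?\<omega> = [1..<Suc (length \<pi>)] \<longleftrightarrow> sorted ?\<omega>"
    using sorted_distinct_set_unique[of ?\<omega> "[1..<Suc (length \<pi>)]"] sorted_upt distinct_upt by metis
  then show ?thesis using True stack_sortable_iff_avoids_231 by (simp add: Sort_def)
qed (simp add: Sort_def)

section \<open>Patterns whose sorted permutations avoid them\<close>

text \<open>If pushing \<open>x\<close> would complete the occurrence \<open>x y z\<^sub>3 \<dots> z\<^sub>k\<close> of \<open>\<sigma>\<close> and therefore expels \<open>y\<close>,
  then \<open>x\<close> lands above the remaining letters, and the output has the subsequence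
  \<open>y x z\<^sub>3 \<dots> z\<^sub>k\<close>, an occurrence of \<open>hat \<sigma>\<close>.\<close>

lemma stack_run_avoiding_hat:
  assumes "length \<sigma> \<ge> 2" "\<not> contains_pattern st \<sigma>"
    "\<not> contains_pattern (stack_run \<sigma> xs (st, out)) (hat \<sigma>)"
  shows "stack_run \<sigma> xs (st, out) = out @ rev xs @ st \<and> \<not> contains_pattern (rev xs @ st) \<sigma>"
  using assms(2,3)
proof (induction xs arbitrary: st)
  case (Cons x xs)
  obtain a b \<tau> where \<sigma>: "\<sigma> = a # b # \<tau>"
    using assms(1) by (metis Suc_le_length_iff numeral_2_eq_2)
  obtain p r where pr: "st = p @ r" "stack_push \<sigma> x (st, out) = (x # r, out @ p)"
    "\<not> contains_pattern (x # r) \<sigma>" "p \<noteq> [] \<Longrightarrow> contains_pattern (x # last p # r) \<sigma>"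
    using stack_push_cases[OF assms(1)] by metis
  obtain w where w: "stack_run \<sigma> xs (x # r, out @ p) = (out @ p) @ w" "subseq (x # r) w"
    using stack_run_extends[OF assms(1)] by metis
  have "p = []"
  proof (rule ccontr)
    assume "p \<noteq> []"
    then obtain q y where q: "p = q @ [y]" by (metis append_butlast_last_id)
    with pr(4) obtain ys where ys: "subseq ys (x # y # r)" "order_isomorphic ys \<sigma>"
      by (auto simp: contains_pattern_def)
    have "\<not> subseq ys (x # r)" using ys(2) pr(3) by (auto simp: contains_pattern_def)
    moreover have "\<not> subseq ys (y # r)"
    proof
      assume "subseq ys (y # r)"
      then have "contains_pattern (y # r) \<sigma>" using ys(2) by (auto simp: contains_pattern_def)
      then have "contains_pattern st \<sigma>"
        by (rule contains_pattern_mono) (simp add: pr(1) q subseq_drop_many)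
      with Cons.prems(1) show False by simp
    qed
    moreover obtain u v zs where uv: "ys = u # v # zs"
      using ys(2) unfolding \<sigma> by (elim order_isomorphic_ConsE) simp
    ultimately have "u = x" "v = y" using ys(1) by (simp_all split: if_splits)
    with ys(1) uv have zs: "ys = x # y # zs" "subseq zs r" by simp_all
    have "order_isomorphic (y # x # zs) (hat \<sigma>)"
      using ys(2) zs(1) \<sigma> order_isomorphic_swap by simp
    moreover have "subseq (y # x # zs) ((out @ p) @ w)"
    proof -
      have "subseq (x # zs) w" using zs(2) w(2) by (meson subseq_Cons2 subseq_order.trans)
      then have "subseq ([y] @ (x # zs)) ((out @ p) @ w)"
        by (intro list_emb_append_mono) (auto simp: q subseq_singleton_left)
      then show ?thesis by simp
    qed
    ultimately show False using Cons.prems(2) pr(2) w(1) by (auto simp: contains_pattern_def)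
  qed
  then show ?case using Cons.IH[of "x # r"] Cons.prems(2) pr by simp
qed simp

lemma order_isomorphic_least_first_iff:
  assumes "\<forall>v\<in>set \<beta>. m < v"
  shows "order_isomorphic (x # xs) (m # \<beta>) \<longleftrightarrow> (\<forall>u\<in>set xs. x < u) \<and> order_isomorphic xs \<beta>"
proof
  assume iso: "order_isomorphic (x # xs) (m # \<beta>)"
  then have iso': "order_isomorphic xs \<beta>"
    and "list_all2 (\<lambda>u v. (x < u \<longleftrightarrow> m < v) \<and> (u < x \<longleftrightarrow> v < m)) xs \<beta>"
    by (auto elim: order_isomorphic_ConsE)
  from this(2) have "\<forall>u\<in>set xs. x < u"
    using assms by (induction rule: list_all2_induct) auto
  with iso' show "(\<forall>u\<in>set xs. x < u) \<and> order_isomorphic xs \<beta>" by simp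
next
  assume R: "(\<forall>u\<in>set xs. x < u) \<and> order_isomorphic xs \<beta>"
  then obtain zs where zs: "xs = map fst zs" "\<beta> = map snd zs"
    "\<forall>p\<in>set zs. \<forall>q\<in>set zs. fst p < fst q \<longleftrightarrow> snd p < snd q"
    unfolding order_isomorphic_iff_zip by iprover
  have "\<forall>q\<in>set zs. x < fst q \<and> \<not> fst q < x \<and> m < snd q \<and> \<not> snd q < m"
    using R assms zs(1,2) by (simp add: order_less_imp_not_less)
  with zs(3) have "\<forall>p\<in>set ((x, m) # zs). \<forall>q\<in>set ((x, m) # zs). fst p < fst q \<longleftrightarrow> snd p < snd q"
    by simp
  with zs(1,2) show "order_isomorphic (x # xs) (m # \<beta>)"
    unfolding order_isomorphic_iff_zip by (intro exI[of _ "(x, m) # zs"]) simp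
qed

text \<open>The last letter that \<open>x\<close> expels belongs to an occurrence in which \<open>x\<close> is the least entry. An
  expelled letter \<open>y \<le> x\<close> would lie above the rest of this occurrence and could replace \<open>x\<close> in it,
  so the pattern would have been in the stack before \<open>x\<close> arrived.\<close>

lemma popped_greater_least_first:
  assumes min: "\<forall>v\<in>set \<beta>. m < v" and "\<beta> \<noteq> []"
    and av: "\<not> contains_pattern (p @ r) (m # \<beta>)" "\<not> contains_pattern (x # r) (m # \<beta>)"
    and force: "contains_pattern (x # last p # r) (m # \<beta>)"
    and y: "y \<in> set p"
  shows "x < y"
proof -
  obtain q where q: "p = q @ [last p]"
    using y by (metis append_butlast_last_id empty_iff list.set(1))
  have lr: "subseq (last p # r) (p @ r)"
    by (subst q) (simp add: subseq_drop_many)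
  obtain u us where us: "subseq (u # us) (x # last p # r)" "order_isomorphic (u # us) (m # \<beta>)"
    using force unfolding contains_pattern_def by (metis order_isomorphic_ConsE)
  have "\<not> subseq (u # us) (last p # r)"
    using us(2) av(1) lr contains_pattern_mono unfolding contains_pattern_def by blast
  then have ux: "u = x" and us_sub: "subseq us (last p # r)"
    using us(1) by (auto split: if_splits)
  have "\<not> subseq us r"
    using us(2) ux av(2) unfolding contains_pattern_def by (metis subseq_Cons2)
  moreover have "us \<noteq> []" using us(2) \<open>\<beta> \<noteq> []\<close> by (auto dest: order_isomorphic_length)
  ultimately have "last p \<in> set us" using us_sub by (cases us) (auto split: if_splits)
  have xus: "\<forall>t\<in>set us. x < t" and iso: "order_isomorphic us \<beta>"
    using us(2) ux order_isomorphic_least_first_iff[OF min] by auto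
  show "x < y"
  proof (cases "y = last p")
    case True
    then show ?thesis using xus \<open>last p \<in> set us\<close> by simp
  next
    case False
    then have yq: "y \<in> set q" using y q by (metis Un_iff empty_iff list.set(1) set_ConsD set_append)
    show ?thesis
    proof (rule ccontr)
      assume "\<not> x < y"
      then have "order_isomorphic (y # us) (m # \<beta>)"
        using xus iso order_isomorphic_least_first_iff[OF min] by fastforce
      moreover have "subseq ([y] @ us) (q @ (last p # r))"
        using yq us_sub by (intro list_emb_append_mono) (auto simp: subseq_singleton_left)
      then have "subseq (y # us) (p @ r)" using q by (metis append.assoc append_Cons append_Nil)
      ultimately show False using av(1) unfolding contains_pattern_def by blast
    qed
  qed
qed

text \<open>Every popped letter keeps a smaller letter in the stack, because the letter that expelled it
  is smaller and so is whatever expels that one later. Suppose that pushing \<open>x\<close> first creates an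
  occurrence of the pattern in the output followed by the stack. The stack alone avoids the pattern,
  so the least entry \<open>u\<close> of the occurrence is already popped, while \<open>x\<close> is a later entry. Some
  letter \<open>z < u\<close> lies under \<open>x\<close> in the stack, and \<open>u x z\<close> is an occurrence of 231 in the output.\<close>

lemma stack_run_least_first_avoids:
  assumes min: "\<forall>v\<in>set \<beta>. m < v" and "\<beta> \<noteq> []"
    and "\<not> contains_pattern (stack_run (m # \<beta>) xs (st, out)) [2, 3, 1]"
    and "\<not> contains_pattern (out @ st) (m # \<beta>)" "\<forall>y\<in>set out. \<exists>z\<in>set st. z < y"
  shows "\<not> contains_pattern (stack_run (m # \<beta>) xs (st, out)) (m # \<beta>)"
  using assms(3-)
proof (induction xs arbitrary: st out)
  case (Cons x xs)
  have len: "length (m # \<beta>) \<ge> 2" using \<open>\<beta> \<noteq> []\<close> by (cases \<beta>) auto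
  obtain p r where pr: "st = p @ r" "stack_push (m # \<beta>) x (st, out) = (x # r, out @ p)"
    "\<not> contains_pattern (x # r) (m # \<beta>)" "p \<noteq> [] \<Longrightarrow> contains_pattern (x # last p # r) (m # \<beta>)"
    using stack_push_cases[OF len] by metis
  have "\<not> contains_pattern (p @ r) (m # \<beta>)"
    using Cons.prems(2) pr(1) contains_pattern_mono[of st _ "out @ st"] by (auto simp: subseq_drop_many)
  then have px: "\<forall>y\<in>set p. x < y"
    using popped_greater_least_first[OF min \<open>\<beta> \<noteq> []\<close>] pr(3,4)
    by (metis empty_iff list.set(1))
  have inv: "\<forall>y\<in>set (out @ p). \<exists>z\<in>set (x # r). z < y"
  proof
    fix y assume "y \<in> set (out @ p)"
    then consider "y \<in> set p" | z where "z \<in> set p" "z < y" | z where "z \<in> set r" "z < y"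
      using Cons.prems(3) pr(1) by fastforce
    then show "\<exists>z\<in>set (x # r). z < y" using px by cases (auto dest: less_trans)
  qed
  obtain w where w: "stack_run (m # \<beta>) xs (x # r, out @ p) = (out @ p) @ w" "subseq (x # r) w"
    using stack_run_extends[OF len] by metis
  have "\<not> contains_pattern ((out @ p) @ x # r) (m # \<beta>)"
  proof
    assume "contains_pattern ((out @ p) @ x # r) (m # \<beta>)"
    then obtain u us where us: "subseq (u # us) ((out @ p) @ x # r)"
      "order_isomorphic (u # us) (m # \<beta>)"
      unfolding contains_pattern_def by (metis order_isomorphic_ConsE)
    then obtain vs ws where vw: "u # us = vs @ ws" "subseq vs (out @ p)" "subseq ws (x # r)"
      by (meson subseq_appendE)
    have "vs \<noteq> []" using vw us(2) pr(3) unfolding contains_pattern_def by (metis append_Nil)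
    then obtain vs' where vs: "vs = u # vs'" "us = vs' @ ws" using vw(1) by (cases vs) auto
    \<comment> \<open>Before the push there was no occurrence, so this one uses \<open>x\<close>.\<close>
    have "\<not> subseq ws r"
    proof
      assume "subseq ws r"
      then have "subseq (u # us) (out @ st)"
        using vw pr(1) list_emb_append_mono[of _ vs "out @ p" ws r] by simp
      with us(2) Cons.prems(2) show False unfolding contains_pattern_def by blast
    qed
    then have "x \<in> set ws" using vw(3) by (cases ws) (auto split: if_splits)
    then have "u < x" using us(2) vs(2) order_isomorphic_least_first_iff[OF min] by simp
    have u: "u \<in> set (out @ p)" using subseq_set_subset[OF vw(2)] vs(1) by simp
    then obtain z where "z \<in> set r" "z < u" using inv \<open>u < x\<close> by fastforce
    then have "subseq [x, z] w"
      using w(2) by (meson subseq_Cons2 subseq_order.trans subseq_singleton_left)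
    then have "subseq ([u] @ [x, z]) ((out @ p) @ w)"
      using u by (intro list_emb_append_mono) (auto simp: subseq_singleton_left)
    then have "subseq [u, x, z] (stack_run (m # \<beta>) (x # xs) (st, out))" using pr(2) w(1) by simp
    then show False
      using Cons.prems(1) \<open>z < u\<close> \<open>u < x\<close> unfolding contains_231_iff by blast
  qed
  then show ?case using Cons.IH[of "x # r" "out @ p"] Cons.prems(1) inv pr(2) by simp
qed simp

section \<open>A sorted permutation that contains its pattern\<close>

lemma order_isomorphic_count_less_first:
  assumes "order_isomorphic (y # ys) (s # ts)"
  shows "length (filter (\<lambda>v. v < y) ys) = length (filter (\<lambda>v. v < s) ts)"
proof -
  have "list_all2 (\<lambda>u v. (y < u \<longleftrightarrow> s < v) \<and> (u < y \<longleftrightarrow> v < s)) ys ts"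
    using assms by (auto elim: order_isomorphic_ConsE)
  then show ?thesis by (induction rule: list_all2_induct) auto
qed

lemma avoids_231_smaller_before_greater:
  assumes "\<not> contains_pattern (s # T) [2, 3, 1]" "s \<notin> set T"
  shows "T = filter (\<lambda>v. v < s) T @ filter (\<lambda>v. s < v) T"
  using assms
proof (induction T)
  case (Cons t T)
  have "\<not> contains_pattern (s # T) [2, 3, 1]"
    using Cons.prems(1) contains_pattern_mono[of "s # T" _ "s # t # T"] by auto
  then have IH: "T = filter (\<lambda>v. v < s) T @ filter (\<lambda>v. s < v) T" using Cons by simp
  show ?case
  proof (cases "t < s")
    case True
    then show ?thesis using IH by simp
  next
    case False
    then have "s < t" using Cons.prems(2) by auto
    have "\<not> v < s" if "v \<in> set T" for v
    proof
      assume "v < s"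
      moreover have "subseq [s, t, v] (s # t # T)" using that by (simp add: subseq_singleton_left)
      ultimately show False using Cons.prems(1) \<open>s < t\<close> unfolding contains_231_iff by blast
    qed
    then have "filter (\<lambda>v. v < s) T = []" by (simp add: filter_empty_conv)
    with IH \<open>s < t\<close> show ?thesis by simp
  qed
qed simp

text \<open>An occurrence of \<open>s # \<tau>\<close> is too long for \<open>B\<close>, so it starts with some \<open>y < s\<close> in \<open>A\<close>. It would
  need at least \<open>s - 1\<close> further entries below \<open>y\<close>, but there are only \<open>y - 1\<close> positive numbers below
  \<open>y\<close>.\<close>

lemma few_smaller_entries_avoids:
  assumes "distinct (A @ B)" "\<forall>v\<in>set A. v < s" "\<forall>v\<in>set (A @ B). 0 < v"
    and "length B \<le> length \<tau>" "s - 1 \<le> length (filter (\<lambda>v. v < s) \<tau>)"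
  shows "\<not> contains_pattern (A @ B) (s # \<tau>)"
proof
  assume "contains_pattern (A @ B) (s # \<tau>)"
  then obtain y ys where ys: "subseq (y # ys) (A @ B)" "order_isomorphic (y # ys) (s # \<tau>)"
    unfolding contains_pattern_def by (metis order_isomorphic_ConsE)
  then obtain vs ws where vw: "y # ys = vs @ ws" "subseq vs A" "subseq ws B"
    by (meson subseq_appendE)
  have "length (y # ys) = length (s # \<tau>)" using ys(2) by (rule order_isomorphic_length)
  moreover have "length ws \<le> length B" using vw(3) by (rule list_emb_length)
  ultimately have "vs \<noteq> []" using vw(1) assms(4) by auto
  then have "y \<in> set vs" using vw(1) by (cases vs) auto
  then have "y \<in> set A" using subseq_set_subset[OF vw(2)] by blast
  then have "y < s" "0 < y" using assms(2,3) by auto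
  define F where "F = filter (\<lambda>v. v < y) ys"
  have "distinct (y # ys)" "set (y # ys) \<subseteq> set (A @ B)"
    using subseq_distinct[OF ys(1) assms(1)] subseq_set_subset[OF ys(1)] by blast+
  then have "distinct F" and pos: "\<forall>v\<in>set F. 0 < v \<and> v < y" using assms(3) by (auto simp: F_def)
  have "set F \<subseteq> {1..<y}" using pos by (auto simp: Suc_le_eq)
  then have "card (set F) \<le> y - 1" using card_mono[of "{1..<y}" "set F"] by simp
  then have "length F \<le> y - 1" using distinct_card[OF \<open>distinct F\<close>] by simp
  moreover have "length F = length (filter (\<lambda>v. v < s) \<tau>)"
    unfolding F_def using ys(2) by (rule order_isomorphic_count_less_first)
  ultimately show False using assms(5) \<open>y < s\<close> \<open>0 < y\<close> by linarith
qed

lemma contains_231_append_greater: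
  assumes "\<forall>u\<in>set A. \<forall>v\<in>set B. u < v" "contains_pattern (A @ B) [2, 3, 1]"
  shows "contains_pattern A [2, 3, 1] \<or> contains_pattern B [2, 3, 1]"
proof -
  obtain a b c where abc: "subseq [a, b, c] (A @ B)" "c < a" "a < b"
    using assms(2) unfolding contains_231_iff by blast
  then obtain vs ws where vw: "[a, b, c] = vs @ ws" "subseq vs A" "subseq ws B"
    by (meson subseq_appendE)
  show ?thesis
  proof (cases "vs = [] \<or> ws = []")
    case True
    then have "subseq [a, b, c] A \<or> subseq [a, b, c] B" using vw by auto
    then show ?thesis using abc(2,3) unfolding contains_231_iff by blast
  next
    case False
    have "a = hd vs" using vw(1) False by (metis hd_append2 list.sel(1))
    moreover have "c = last ws" using vw(1) False by (metis last.simps last_appendR list.distinct(1))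
    ultimately have "a \<in> set A" "c \<in> set B"
      using False subseq_set_subset[OF vw(2)] subseq_set_subset[OF vw(3)] by auto
    then have "a < c" using assms(1) by blast
    with abc(2) show ?thesis by simp
  qed
qed

text \<open>The input has to expel a letter playing \<open>s\<close> before the letter playing 1 arrives. The letter \<open>s\<close>
  is expelled by \<open>s + d\<close>, for which it plays the entry 1 of a copy of the pattern whose other entries
  are all above \<open>s\<close>. The letters \<open>L\<close> and 1 are pushed only afterwards, on top of \<open>s + d\<close>: then
  everything below \<open>s\<close> precedes everything above \<open>s\<close> in the output, and no 231 can mix the two.\<close>

lemma least_second_not_effective:
  assumes perm: "s # 1 # T \<in> permutations_of_set {1..k}"
    and av: "\<not> contains_pattern (s # 1 # T) [2, 3, 1]"
  shows "\<not> effective (s # 1 # T)"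
proof -
  define \<sigma> where "\<sigma> = s # 1 # T"
  define d where "d = s - 1"
  define L where "L = filter (\<lambda>v. v < s) T"
  define U where "U = filter (\<lambda>v. s < v) T"
  define T' where "T' = map (\<lambda>v. v + d) T"
  define \<pi> where "\<pi> = rev (s # T') @ (s + d) # rev (1 # L)"
  define \<omega> where "\<omega> = s # 1 # L @ (s + d) # T'"
  have set\<sigma>: "insert s (insert 1 (set T)) = {1..k}" and dist: "distinct (s # 1 # T)"
    using perm by (auto simp: permutations_of_set_def)
  have "s \<in> {1..k}" "s \<noteq> 1" using set\<sigma> dist by auto
  then have s: "2 \<le> s" "s \<le> k" by auto
  have d: "1 \<le> d" "s = d + 1" using s(1) by (auto simp: d_def)
  have "set T = insert s (insert 1 (set T)) - {s, 1}" using dist by auto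
  also have "\<dots> = {1..k} - {s, 1}" by (simp only: set\<sigma>)
  also have "\<dots> = {2..k} - {s}" by auto
  finally have setT: "set T = {2..k} - {s}" .
  have len\<sigma>: "length \<sigma> \<ge> 2" and len: "length T' = length T" "length \<sigma> = length T + 2"
    by (simp_all add: \<sigma>_def T'_def)
  have av_sT: "\<not> contains_pattern (s # T) [2, 3, 1]"
    using av contains_pattern_mono[of "s # T" _ "s # 1 # T"] by auto
  then have TLU: "T = L @ U"
    unfolding L_def U_def using dist by (intro avoids_231_smaller_before_greater) simp_all
  have setL: "set L = {2..<s}" unfolding L_def set_filter setT using s by auto
  have setT': "set T' = {s + 1..k + d} - {s + d}"
  proof -
    have "set T' = (\<lambda>v. v + d) ` ({2..k} - {s})" using setT by (simp add: T'_def)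
    also have "\<dots> = (\<lambda>v. v + d) ` {2..k} - {s + d}"
      by (simp add: image_set_diff inj_on_def)
    also have "(\<lambda>v. v + d) ` {2..k} = {s + 1..k + d}" using d by simp
    finally show ?thesis .
  qed
  have "distinct L" "distinct T'" using dist by (simp_all add: L_def T'_def distinct_map)
  then have dist\<omega>: "distinct \<omega>"
    using setL setT' d by (simp add: \<omega>_def) (auto simp: disjoint_iff)
  have set\<omega>: "set \<omega> = {1..k + d}"
    using setL setT' s d by (simp add: \<omega>_def) auto
  have mset\<pi>: "mset \<pi> = mset \<omega>" by (simp add: \<pi>_def \<omega>_def)
  have "distinct \<pi>" using dist\<omega> mset_eq_imp_distinct_iff[OF mset\<pi>] by simp
  moreover have "set \<pi> = {1..k + d}" using set\<omega> mset_eq_setD[OF mset\<pi>] by simp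
  ultimately have perm\<pi>: "is_permutation \<pi>"
    using distinct_card[of \<pi>] by (simp add: is_permutation_iff)
  have short: "\<not> contains_pattern xs \<sigma>" if "length xs \<le> length T + 1" for xs
    using that contains_pattern_length len(2) by fastforce
  have iso_shift: "order_isomorphic ((s + d) # T') (s # T)"
    using order_isomorphic_map[of "s # T" "\<lambda>v. v + d"] by (simp add: T'_def strict_mono_on_def)
  have run: "stack_map \<sigma> \<pi> = \<omega>"
  proof -
    have "\<not> contains_pattern (rev (rev (s # T')) @ []) \<sigma>"
      by (rule short) (simp add: len(1))
    then have "stack_map \<sigma> \<pi> = stack_run \<sigma> ((s + d) # rev (1 # L)) (rev (rev (s # T')) @ [], [])"
      unfolding stack_map_def \<pi>_def by (rule stack_run_no_pop)
    also have "\<dots> = stack_run \<sigma> (rev (1 # L) @ []) ((s + d) # T', [s])"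
    proof -
      have "order_isomorphic (map (\<lambda>v. v + d) \<sigma>) \<sigma>"
        by (rule order_isomorphic_map) (simp add: strict_mono_on_def)
      moreover have "map (\<lambda>v. v + d) \<sigma> = (s + d) # s # T'" using d by (simp add: \<sigma>_def T'_def)
      ultimately have "contains_pattern ((s + d) # s # T') \<sigma>"
        unfolding contains_pattern_def by (metis subseq_order.order_refl)
      moreover have "\<not> contains_pattern ((s + d) # T') \<sigma>"
        by (rule short) (simp add: len(1))
      ultimately have "stack_push \<sigma> (s + d) (s # T', []) = ((s + d) # T', [s])"
        by (cases T') simp_all
      then show ?thesis by simp
    qed
    also have "\<dots> = stack_run \<sigma> [] (rev (rev (1 # L)) @ (s + d) # T', [s])"
    proof (rule stack_run_no_pop)
      have "set (filter (\<lambda>v. v < s) (1 # T)) = {1..<s}"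
        unfolding set_filter list.set setT using s by auto
      moreover have "distinct (filter (\<lambda>v. v < s) (1 # T))" using dist by simp
      ultimately have "length (filter (\<lambda>v. v < s) (1 # T)) = s - 1"
        by (metis card_atLeastLessThan distinct_card)
      moreover have "\<forall>v\<in>set ((1 # L) @ (s + d) # T'). 0 < v"
        unfolding set_append list.set setL setT' using s by auto
      moreover have "\<forall>v\<in>set (1 # L). v < s" unfolding list.set setL using s by auto
      moreover have "distinct ((1 # L) @ (s + d) # T')" using dist\<omega> by (simp add: \<omega>_def)
      ultimately have "\<not> contains_pattern ((1 # L) @ (s + d) # T') (s # 1 # T)"
        by (intro few_smaller_entries_avoids) (simp_all add: len(1))
      then show "\<not> contains_pattern (rev (rev (1 # L)) @ (s + d) # T') \<sigma>"
        by (simp add: \<sigma>_def)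
    qed
    finally show ?thesis by (simp add: \<omega>_def)
  qed
  have "contains_pattern \<omega> \<sigma>"
  proof -
    \<comment> \<open>Both \<open>T\<close> and its shifted copy have their large entries at the end, so the unshifted small
      entries of the pattern can be combined with the shifted large ones.\<close>
    define f where "f v = (if v \<le> s then v else v + d)" for v
    have "strict_mono_on (set \<sigma>) f" by (auto simp: strict_mono_on_def f_def)
    then have "order_isomorphic (map f \<sigma>) \<sigma>" by (rule order_isomorphic_map)
    moreover have "map f L = L" using setL by (auto simp: f_def intro: map_idI)
    moreover have "map f U = map (\<lambda>v. v + d) U" by (auto simp: f_def U_def)
    ultimately have "order_isomorphic (s # 1 # L @ map (\<lambda>v. v + d) U) \<sigma>"
      using s by (simp add: \<sigma>_def TLU f_def)
    moreover have "subseq (map (\<lambda>v. v + d) U) ((s + d) # T')"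
      unfolding T'_def TLU map_append by (intro list_emb_Cons subseq_drop_many) simp
    then have "subseq (s # 1 # L @ map (\<lambda>v. v + d) U) \<omega>"
      unfolding \<omega>_def by (simp add: subseq_append')
    ultimately show ?thesis unfolding contains_pattern_def by blast
  qed
  moreover have "\<not> contains_pattern \<omega> [2, 3, 1]"
  proof
    assume "contains_pattern \<omega> [2, 3, 1]"
    then have "contains_pattern ((s # 1 # L) @ (s + d) # T') [2, 3, 1]" by (simp add: \<omega>_def)
    moreover have "\<forall>u\<in>set (s # 1 # L). \<forall>v\<in>set ((s + d) # T'). u < v"
      unfolding list.set setL setT' using s d by auto
    ultimately consider "contains_pattern (s # 1 # L) [2, 3, 1]"
      | "contains_pattern ((s + d) # T') [2, 3, 1]"
      using contains_231_append_greater by blast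
    then show False
    proof cases
      case 1
      moreover have "subseq (s # 1 # L) (s # 1 # T)" by (simp add: L_def)
      ultimately show False using av contains_pattern_mono by blast
    next
      case 2
      moreover have "order_isomorphic (s # T) ((s + d) # T')"
        using iso_shift by (simp add: order_isomorphic_def)
      then have "contains_pattern (s # T) ((s + d) # T')"
        unfolding contains_pattern_def by (metis subseq_order.order_refl)
      ultimately show False using av_sT contains_pattern_trans by blast
    qed
  qed
  ultimately have "\<pi> \<in> Sort \<sigma>" "stack_map \<sigma> \<pi> \<notin> Av \<sigma>"
    using run perm\<pi> Sort_iff[OF len\<sigma>] by (simp_all add: Av_def)
  then show ?thesis unfolding effective_def Sorted_def \<sigma>_def by blast
qed

section \<open>The characterisation\<close>

lemma effectiveI:
  assumes "length \<sigma> \<ge> 2"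
    and "\<And>\<pi>. \<not> contains_pattern (stack_map \<sigma> \<pi>) [2, 3, 1] \<Longrightarrow> \<not> contains_pattern (stack_map \<sigma> \<pi>) \<sigma>"
  shows "effective \<sigma>"
  using assms Sort_iff is_permutation_stack_map by (auto simp: effective_def Sorted_def Av_def)

lemma contains_231_effective:
  assumes "length \<sigma> \<ge> 2" "contains_pattern \<sigma> [2, 3, 1]"
  shows "effective \<sigma>"
  using assms contains_pattern_trans effectiveI by blast

lemma hat_contains_231_effective:
  assumes "length \<sigma> \<ge> 2" "contains_pattern (hat \<sigma>) [2, 3, 1]"
  shows "effective \<sigma>"
proof (rule effectiveI[OF assms(1)])
  fix \<pi> assume "\<not> contains_pattern (stack_map \<sigma> \<pi>) [2, 3, 1]"
  then have "\<not> contains_pattern (stack_map \<sigma> \<pi>) (hat \<sigma>)"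
    using assms(2) contains_pattern_trans by blast
  moreover have "\<not> contains_pattern [] \<sigma>" using assms(1) contains_pattern_length by fastforce
  ultimately show "\<not> contains_pattern (stack_map \<sigma> \<pi>) \<sigma>"
    using stack_run_avoiding_hat[OF assms(1), of "[]" \<pi> "[]"] by (simp add: stack_map_def)
qed

lemma least_first_effective:
  assumes "\<forall>v\<in>set \<beta>. m < v" "\<beta> \<noteq> []"
  shows "effective (m # \<beta>)"
proof (rule effectiveI)
  show len: "length (m # \<beta>) \<ge> 2" using assms(2) by (cases \<beta>) auto
  have "\<not> contains_pattern [] (m # \<beta>)" using contains_pattern_length by fastforce
  then show "\<not> contains_pattern (stack_map (m # \<beta>) \<pi>) (m # \<beta>)"
    if "\<not> contains_pattern (stack_map (m # \<beta>) \<pi>) [2, 3, 1]" for \<pi>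
    using stack_run_least_first_avoids[OF assms, of \<pi> "[]" "[]"] that by (simp add: stack_map_def)
qed

text \<open>The least entry \<open>m\<close> could only be the last entry of an occurrence of 231, and in second position
  it has too few entries before it.\<close>

lemma contains_231_drop_second_least:
  assumes "\<forall>v\<in>set (a # T). m < v"
  shows "contains_pattern (a # m # T) [2, 3, 1] \<longleftrightarrow> contains_pattern (a # T) [2, 3, 1]"
proof
  assume "contains_pattern (a # m # T) [2, 3, 1]"
  then obtain x y z where xyz: "subseq [x, y, z] (a # m # T)" "z < x" "x < y"
    unfolding contains_231_iff by blast
  have "z \<in> set (m # T)" using subseq_set_subset[OF xyz(1)] xyz(1)
    by (auto split: if_splits dest: subseq_set_subset)
  then have "m \<le> z" using assms by auto
  then have "x \<noteq> m" "y \<noteq> m" using xyz by auto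
  then have "subseq [x, y, z] (a # T)" using xyz(1) by (auto split: if_splits)
  then show "contains_pattern (a # T) [2, 3, 1]" using xyz unfolding contains_231_iff by blast
next
  assume "contains_pattern (a # T) [2, 3, 1]"
  then show "contains_pattern (a # m # T) [2, 3, 1]"
    by (rule contains_pattern_mono) auto
qed

lemma contains_pattern_map_Suc:
  "contains_pattern (map Suc \<alpha>) \<tau> \<longleftrightarrow> contains_pattern \<alpha> \<tau>"
proof -
  have iso: "order_isomorphic (map Suc \<alpha>) \<alpha>"
    by (rule order_isomorphic_map) (simp add: strict_mono_on_def)
  then have "contains_pattern (map Suc \<alpha>) \<alpha>" unfolding contains_pattern_def by blast
  moreover have "contains_pattern \<alpha> (map Suc \<alpha>)"
    using iso unfolding contains_pattern_def order_isomorphic_def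
    by (metis subseq_order.order_refl)
  ultimately show ?thesis using contains_pattern_trans by blast
qed

lemma one_oplus_of_permutation:
  assumes "1 # xs \<in> permutations_of_set {1..k}"
  obtains \<alpha> where "is_permutation \<alpha>" "1 # xs = one_oplus \<alpha>"
proof -
  have dist: "distinct xs" "1 \<notin> set xs" and set1: "insert 1 (set xs) = {1..k}"
    using assms by (auto simp: permutations_of_set_def)
  have set_xs: "set xs = {2..k}"
  proof (rule set_eqI)
    fix v show "v \<in> set xs \<longleftrightarrow> v \<in> {2..k}"
      using set1[THEN eqset_imp_iff, of v] dist(2) by (cases "v = 1") auto
  qed
  define \<alpha> where "\<alpha> = map (\<lambda>v. v - 1) xs"
  have xs: "xs = map Suc \<alpha>" using set_xs by (auto simp: \<alpha>_def comp_def intro!: map_idI[symmetric])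
  have "length \<alpha> = k - 1" using set_xs dist(1) distinct_card[of xs] by (simp add: \<alpha>_def)
  moreover have "set \<alpha> = {1..k - 1}"
  proof (rule set_eqI)
    fix v show "v \<in> set \<alpha> \<longleftrightarrow> v \<in> {1..k - 1}"
      using set_xs[THEN eqset_imp_iff, of "Suc v"] xs by auto
  qed
  moreover have "distinct \<alpha>" using dist(1) xs by (simp add: distinct_map)
  ultimately have "is_permutation \<alpha>" unfolding is_permutation_iff by simp
  then show ?thesis using that xs by (simp add: one_oplus_def)
qed

theorem corollary7p6:
  fixes \<sigma> :: "nat list" and k :: nat
  assumes "k \<ge> 2"
    and "\<sigma> \<in> permutations_of_set {1..k}"
  shows "\<not> effective \<sigma> \<longleftrightarrow> (\<exists>\<alpha> \<in> Av [2, 3, 1]. hat \<sigma> = one_oplus \<alpha>)"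
proof -
  have dist: "distinct \<sigma>" and set\<sigma>: "set \<sigma> = {1..k}"
    using assms(2) by (auto simp: permutations_of_set_def)
  have len: "length \<sigma> \<ge> 2" using distinct_card[OF dist] set\<sigma> assms(1) by simp
  then obtain a b T where \<sigma>: "\<sigma> = a # b # T"
    by (metis Suc_le_length_iff numeral_2_eq_2)
  have ge1: "\<forall>v\<in>set \<sigma>. 1 \<le> v" using set\<sigma> by auto
  show ?thesis
  proof
    assume noteff: "\<not> effective \<sigma>"
    have av: "\<not> contains_pattern \<sigma> [2, 3, 1]" "\<not> contains_pattern (hat \<sigma>) [2, 3, 1]"
      using noteff len contains_231_effective hat_contains_231_effective by blast+
    have "a \<noteq> 1"
    proof
      assume "a = 1"
      then have "\<forall>v\<in>set (b # T). a < v" using ge1 dist \<sigma> by (auto simp: le_less)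
      then show False using least_first_effective noteff \<sigma> by blast
    qed
    \<comment> \<open>Otherwise 231 occurs in \<open>\<sigma>\<close> if \<open>a < b\<close>, and in \<open>hat \<sigma>\<close> if \<open>b < a\<close>.\<close>
    have "1 \<notin> set T"
    proof
      assume "1 \<in> set T"
      then have sub: "subseq [a, b, 1] \<sigma>" "subseq [b, a, 1] (hat \<sigma>)"
        by (auto simp: \<sigma> subseq_singleton_left)
      have "a > 1" "b > 1" "a < b \<or> b < a"
        using ge1 dist \<sigma> \<open>1 \<in> set T\<close> \<open>a \<noteq> 1\<close> by (auto simp: le_less)
      then show False using av sub unfolding contains_231_iff by blast
    qed
    have "1 \<in> set \<sigma>" using set\<sigma> assms(1) by simp
    then have b: "b = 1" using \<open>a \<noteq> 1\<close> \<open>1 \<notin> set T\<close> \<sigma> by auto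
    then have "1 # a # T \<in> permutations_of_set {1..k}"
      using assms(2) \<sigma> by (auto simp: permutations_of_set_def insert_commute)
    then obtain \<alpha> where \<alpha>: "is_permutation \<alpha>" "1 # a # T = one_oplus \<alpha>"
      using one_oplus_of_permutation by blast
    then have "a # T = map Suc \<alpha>" by (simp add: one_oplus_def)
    moreover have "\<not> contains_pattern (a # T) [2, 3, 1]"
      using av(1) \<sigma> b contains_pattern_mono[of "a # T" _ "a # 1 # T"] by auto
    ultimately have "\<alpha> \<in> Av [2, 3, 1]" using \<alpha>(1) by (simp add: Av_def contains_pattern_map_Suc)
    moreover have "hat \<sigma> = one_oplus \<alpha>" using \<alpha>(2) \<sigma> b by simp
    ultimately show "\<exists>\<alpha>\<in>Av [2, 3, 1]. hat \<sigma> = one_oplus \<alpha>" by blast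
  next
    assume "\<exists>\<alpha>\<in>Av [2, 3, 1]. hat \<sigma> = one_oplus \<alpha>"
    then obtain \<alpha> where \<alpha>: "\<alpha> \<in> Av [2, 3, 1]" "b = 1" "a # T = map Suc \<alpha>"
      using \<sigma> by (auto simp: one_oplus_def)
    have "\<not> contains_pattern (a # T) [2, 3, 1]"
      using \<alpha> by (simp add: Av_def contains_pattern_map_Suc)
    moreover have "\<forall>v\<in>set (a # T). 1 < v" using ge1 dist \<sigma> \<alpha>(2) by (auto simp: le_less)
    ultimately have "\<not> contains_pattern (a # 1 # T) [2, 3, 1]"
      using contains_231_drop_second_least by blast
    then show "\<not> effective \<sigma>"
      using least_second_not_effective assms(2) \<sigma> \<alpha>(2) by blast
  qed
qed

end
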